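(* Let $\mathcal{E}$ be a finite-dimensional real Hilbert space with inner product $\langle\cdot,\cdot\rangle$, let $M:\mathcal{E}\to\mathcal{E}$ be a self-adjoint linear operator, and let $Q\subseteq\mathcal{E}$ be a closed convex cone with nonempty interior. Assume that $\langle u,Mu\rangle>0$ for all $u\in\operatorname{bdry}Q\setminus\{0\}$. Then exactly one of the following two assertions is true: (1) $\langle u,Mu\rangle>0$ for all $u\in\operatorname{int}Q$. (2) There exist $v\in-\operatorname{int}Q$ and $\lambda\ge0$ such that $Mv=-\lambda v\in Q$.
   Context: $\operatorname{int}Q$ and $\operatorname{bdry}Q$ denote the interior and the boundary of $Q$ in $\mathcal{E}$. *)

theory Defs imports "HOL-Analysis.Analysis" begin

end

theory Submission imports Defs begin

text \<open>
  The two assertions exclude each other: if \<open>M v = - l v\<close> with \<open>- v\<close> interior and \<open>l \<ge> 0\<close>,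
  then the quadratic form takes the value \<open>- l \<parallel>v\<parallel>\<^sup>2 \<le> 0\<close> at \<open>- v\<close>.

  Conversely, suppose the form is nonpositive somewhere in the interior of \<open>Q\<close>. The idea is to
  minimise the Rayleigh quotient, that is, the form on the compact set of unit vectors of \<open>Q\<close>.
  The minimum \<open>\<mu>\<close> is nonpositive, so the minimiser \<open>w\<close> cannot lie on the boundary, where the form
  is positive. Because \<open>Q\<close> is a cone, \<open>x \<bullet> (M x - \<mu> x)\<close> is nonnegative on all of \<open>Q\<close> and vanishes
  at the interior point \<open>w\<close>; the first-order condition there is \<open>M w = \<mu> w\<close>
  (\<open>selfadjoint_kernel_of_interior_zero\<close>), and \<open>v = - w\<close>, \<open>l = - \<mu>\<close> are as required. Only the
  case \<open>0 \<in> interior Q\<close> is exceptional, since the nonpositive value may then be attained at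
  the origin alone; there \<open>v = 0\<close> is a witness.

  The space is finite-dimensional through a finite spanning set rather than through the class
  \<open>euclidean_space\<close>, so compactness of balls and continuity of linear maps are derived first, from
  the expansion of a vector in an orthogonal spanning set.
\<close>

section \<open>Finitely spanned inner product spaces\<close>

text \<open>
  The spanning set produced by orthogonalisation may contain \<open>0\<close>. Since \<open>sgn 0 = 0\<close>,
  normalising with \<open>sgn\<close> keeps the usual expansion formula valid without removing it.
\<close>

lemma orthonormal_expansion:
  fixes B :: "'a::real_inner set"
  assumes "finite B" "span B = UNIV"
  obtains C :: "'a set" where "finite C" "\<And>x. x = (\<Sum>c\<in>C. (x \<bullet> sgn c) *\<^sub>R sgn c)"
proof -
  obtain C where "finite C \<and> card C \<le> card B \<and> span C = span B \<and> pairwise orthogonal C"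
    using basis_orthogonal[OF assms(1)] ..
  with assms(2) have C: "finite C" "span C = UNIV" "pairwise orthogonal C"
    by simp_all
  have "x = (\<Sum>c\<in>C. (x \<bullet> sgn c) *\<^sub>R sgn c)" for x
  proof -
    have "x \<in> range (\<lambda>u. \<Sum>c\<in>C. u c *\<^sub>R c)"
      using span_finite[OF C(1)] C(2) by auto
    then obtain u where u: "x = (\<Sum>c\<in>C. u c *\<^sub>R c)"
      by blast
    have "u c *\<^sub>R c = (x \<bullet> sgn c) *\<^sub>R sgn c" if "c \<in> C" for c
    proof (cases "c = 0")
      case False
      have "x \<bullet> c = (\<Sum>d\<in>C. u d * (d \<bullet> c))"
        by (simp add: u inner_sum_left)
      also have "\<dots> = (\<Sum>d\<in>C. if d = c then u c * (c \<bullet> c) else 0)"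
        using C(3) that by (intro sum.cong) (auto simp: pairwise_def orthogonal_def)
      also have "\<dots> = u c * (norm c)\<^sup>2"
        using C(1) that by (simp add: dot_square_norm)
      finally show ?thesis
        using False by (simp add: sgn_div_norm power2_eq_square field_simps)
    qed simp
    then have "(\<Sum>c\<in>C. u c *\<^sub>R c) = (\<Sum>c\<in>C. (x \<bullet> sgn c) *\<^sub>R sgn c)"
      by (rule sum.cong[OF refl])
    with u show ?thesis
      by (rule trans)
  qed
  with C(1) show ?thesis
    by (rule that)
qed

lemma compact_bounded_combinations:
  fixes e :: "'i \<Rightarrow> 'a::real_normed_vector"
  assumes "finite I"
  shows "compact {\<Sum>i\<in>I. f i *\<^sub>R e i | f. \<forall>i\<in>I. \<bar>f i\<bar> \<le> (r::real)}"
  using assms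
proof induction
  case empty
  then show ?case by simp
next
  case (insert j I)
  let ?K = "\<lambda>I. {\<Sum>i\<in>I. f i *\<^sub>R e i | f. \<forall>i\<in>I. \<bar>f i\<bar> \<le> r}"
  have "?K (insert j I) = (\<lambda>p. fst p *\<^sub>R e j + snd p) ` ({-r..r} \<times> ?K I)"
  proof (intro equalityI subsetI)
    fix x assume "x \<in> ?K (insert j I)"
    then obtain f where f: "\<forall>i\<in>insert j I. \<bar>f i\<bar> \<le> r" "x = (\<Sum>i\<in>insert j I. f i *\<^sub>R e i)"
      by blast
    then have "x = f j *\<^sub>R e j + (\<Sum>i\<in>I. f i *\<^sub>R e i)"
      using insert.hyps by simp
    moreover have "(f j, \<Sum>i\<in>I. f i *\<^sub>R e i) \<in> {-r..r} \<times> ?K I"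
      using f(1) by (auto simp: abs_le_iff)
    ultimately show "x \<in> (\<lambda>p. fst p *\<^sub>R e j + snd p) ` ({-r..r} \<times> ?K I)"
      by force
  next
    fix x assume "x \<in> (\<lambda>p. fst p *\<^sub>R e j + snd p) ` ({-r..r} \<times> ?K I)"
    then obtain t f where tf: "t \<in> {-r..r}" "\<forall>i\<in>I. \<bar>f i\<bar> \<le> r"
        "x = t *\<^sub>R e j + (\<Sum>i\<in>I. f i *\<^sub>R e i)"
      by auto
    have "(\<Sum>i\<in>I. (f(j := t)) i *\<^sub>R e i) = (\<Sum>i\<in>I. f i *\<^sub>R e i)"
      using insert.hyps by (intro sum.cong) auto
    then have "x = (\<Sum>i\<in>insert j I. (f(j := t)) i *\<^sub>R e i)"
      using insert.hyps tf(3) by simp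
    moreover have "\<forall>i\<in>insert j I. \<bar>(f(j := t)) i\<bar> \<le> r"
      using tf by (auto simp: abs_le_iff)
    ultimately show "x \<in> ?K (insert j I)"
      by blast
  qed
  moreover have "compact ((\<lambda>p. fst p *\<^sub>R e j + snd p) ` ({-r..r} \<times> ?K I))"
    by (intro compact_continuous_image continuous_intros compact_Times insert.IH) simp
  ultimately show ?case
    by simp
qed

text \<open>
  By Cauchy-Schwarz the coefficients of \<open>x\<close> against unit vectors are bounded by \<open>\<parallel>x\<parallel>\<close>, so the
  expansion places the ball inside a compact set of bounded combinations.
\<close>

lemma compact_cball_finite_span:
  fixes B :: "'a::real_inner set"
  assumes "finite B" "span B = UNIV"
  shows "compact (cball (0::'a) r)"
proof -
  obtain C :: "'a set" where C: "finite C" "\<And>x. x = (\<Sum>c\<in>C. (x \<bullet> sgn c) *\<^sub>R sgn c)"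
    using orthonormal_expansion[OF assms] by blast
  let ?K = "{\<Sum>c\<in>C. f c *\<^sub>R sgn c | f. \<forall>c\<in>C. \<bar>f c\<bar> \<le> r}"
  have "x \<in> ?K" if "x \<in> cball 0 r" for x
  proof -
    have "\<bar>x \<bullet> sgn c\<bar> \<le> r" for c
    proof -
      have "\<bar>x \<bullet> sgn c\<bar> \<le> norm x * norm (sgn c)"
        by (rule Cauchy_Schwarz_ineq2)
      also have "\<dots> \<le> norm x"
        by (simp add: norm_sgn)
      finally show ?thesis
        using that by simp
    qed
    then have "\<forall>c\<in>C. \<bar>x \<bullet> sgn c\<bar> \<le> r"
      by blast
    then have "\<exists>f. x = (\<Sum>c\<in>C. f c *\<^sub>R sgn c) \<and> (\<forall>c\<in>C. \<bar>f c\<bar> \<le> r)"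
      by (intro exI[of _ "\<lambda>c. x \<bullet> sgn c"] conjI) (rule C(2))
    then show ?thesis
      by (rule CollectI)
  qed
  then have "?K \<inter> cball 0 r = cball 0 r"
    by blast
  moreover have "compact (?K \<inter> cball 0 r)"
    by (intro compact_Int_closed compact_bounded_combinations C(1) closed_cball)
  ultimately show ?thesis
    by (rule subst[of _ _ compact])
qed

lemma linear_continuous_on_finite_span:
  fixes B :: "'a::real_inner set" and M :: "'a \<Rightarrow> 'b::real_normed_vector"
  assumes "finite B" "span B = UNIV" "linear M"
  shows "continuous_on S M"
proof -
  obtain C :: "'a set" where C: "finite C" "\<And>x. x = (\<Sum>c\<in>C. (x \<bullet> sgn c) *\<^sub>R sgn c)"
    using orthonormal_expansion[OF assms(1,2)] by blast
  have eq: "M x = (\<Sum>c\<in>C. (x \<bullet> sgn c) *\<^sub>R M (sgn c))" for x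
  proof -
    have "M x = M (\<Sum>c\<in>C. (x \<bullet> sgn c) *\<^sub>R sgn c)"
      by (rule arg_cong[OF C(2)])
    also have "\<dots> = (\<Sum>c\<in>C. (x \<bullet> sgn c) *\<^sub>R M (sgn c))"
      by (simp only: linear_sum[OF assms(3)] linear_scale[OF assms(3)])
    finally show ?thesis .
  qed
  have "continuous_on S M \<longleftrightarrow> continuous_on S (\<lambda>x. \<Sum>c\<in>C. (x \<bullet> sgn c) *\<^sub>R M (sgn c))"
    by (rule continuous_on_cong[OF refl eq])
  moreover have "continuous_on S (\<lambda>x. \<Sum>c\<in>C. (x \<bullet> sgn c) *\<^sub>R M (sgn c))"
    by (intro continuous_intros)
  ultimately show ?thesis
    by (rule iffD2)
qed

section \<open>Minimising a quadratic form over a cone\<close>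

text \<open>
  This is the first-order optimality condition. Moving from \<open>w\<close> in the direction \<open>- A w\<close>
  changes the form to first order at rate \<open>- 2 \<parallel>A w\<parallel>\<^sup>2\<close>, so a nonzero \<open>A w\<close> would make it
  negative at nearby points, which still lie in \<open>S\<close>.
\<close>

lemma selfadjoint_kernel_of_interior_zero:
  fixes A :: "'a::real_inner \<Rightarrow> 'a"
  assumes "linear A" and sa: "\<And>x y. A x \<bullet> y = x \<bullet> A y"
    and nonneg: "\<And>x. x \<in> S \<Longrightarrow> 0 \<le> x \<bullet> A x"
    and w: "w \<in> interior S" "w \<bullet> A w = 0"
  shows "A w = 0"
proof -
  let ?g = "A w"
  let ?c = "?g \<bullet> A ?g"
  have form_eq: "(w - t *\<^sub>R ?g) \<bullet> A (w - t *\<^sub>R ?g) = t * (t * ?c - 2 * (?g \<bullet> ?g))" for t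
  proof -
    have "w \<bullet> A ?g = ?g \<bullet> ?g"
      using sa[of w ?g] by simp
    then show ?thesis
      using w(2) by (simp add: linear_diff[OF assms(1)] linear_scale[OF assms(1)]
          inner_diff algebra_simps inner_commute)
  qed
  have "((\<lambda>t. w - t *\<^sub>R ?g) \<longlongrightarrow> w) (at_right 0)"
    by (auto intro!: tendsto_eq_intros)
  then have "\<forall>\<^sub>F t in at_right 0. w - t *\<^sub>R ?g \<in> interior S"
    using open_interior w(1) by (rule topological_tendstoD)
  then have "\<forall>\<^sub>F t in at_right (0::real). 0 \<le> t * ?c - 2 * (?g \<bullet> ?g)"
    using eventually_at_right_less[of "0::real"]
  proof eventually_elim
    case (elim t)
    then have "0 \<le> t * (t * ?c - 2 * (?g \<bullet> ?g))"
      using nonneg[of "w - t *\<^sub>R ?g"] interior_subset[of S] unfolding form_eq by blast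
    then show ?case
      using elim(2) by (simp add: zero_le_mult_iff)
  qed
  moreover have "((\<lambda>t. t * ?c - 2 * (?g \<bullet> ?g)) \<longlongrightarrow> - 2 * (?g \<bullet> ?g)) (at_right 0)"
    by (auto intro!: tendsto_eq_intros)
  ultimately have "0 \<le> - 2 * (?g \<bullet> ?g)"
    by (intro tendsto_lowerbound[of _ _ "at_right (0::real)"]) auto
  then have "\<not> 0 < ?g \<bullet> ?g"
    by linarith
  then show ?thesis
    by (simp only: inner_gt_zero_iff not_not)
qed

text \<open>
  Rescaling into the cone turns minimality among unit vectors into a homogeneous inequality
  on all of \<open>Q\<close>, a form in which it can be differentiated without a norm constraint.
\<close>

lemma cone_rayleigh_minimiser:
  fixes M :: "'a::real_inner \<Rightarrow> 'a" and B :: "'a set"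
  assumes "finite B" "span B = UNIV" "linear M" "closed Q" "cone Q"
    and u: "u \<in> Q" "u \<noteq> 0"
  obtains w where "w \<in> Q" "norm w = 1" "\<And>x. x \<in> Q \<Longrightarrow> (w \<bullet> M w) * (x \<bullet> x) \<le> x \<bullet> M x"
proof -
  let ?K = "Q \<inter> sphere 0 1"
  have sgn_in: "sgn x \<in> ?K" if "x \<in> Q" "x \<noteq> 0" for x
    using that mem_cone[OF \<open>cone Q\<close> that(1), of "inverse (norm x)"]
    by (simp add: norm_sgn) (simp add: sgn_div_norm)
  have "closed {x::'a. norm x = 1}"
    by (intro closed_Collect_eq continuous_intros)
  then have "closed (sphere (0::'a) 1)"
    by (simp add: sphere_def)
  then have "compact (cball (0::'a) 1 \<inter> ?K)"
    by (intro compact_Int_closed compact_cball_finite_span[OF assms(1,2)] closed_Int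
        \<open>closed Q\<close>)
  moreover have "cball (0::'a) 1 \<inter> ?K = ?K"
    by auto
  ultimately have "compact ?K"
    by simp
  moreover have "continuous_on ?K (\<lambda>x. x \<bullet> M x)"
    by (intro continuous_intros linear_continuous_on_finite_span[OF assms(1,2,3)])
  ultimately obtain w where w: "w \<in> ?K" "\<forall>x\<in>?K. w \<bullet> M w \<le> x \<bullet> M x"
    using continuous_attains_inf[of ?K "\<lambda>x. x \<bullet> M x"] sgn_in[OF u] by blast
  have "(w \<bullet> M w) * (x \<bullet> x) \<le> x \<bullet> M x" if "x \<in> Q" for x
  proof (cases "x = 0")
    case False
    have "x \<bullet> M x = (norm x *\<^sub>R sgn x) \<bullet> M (norm x *\<^sub>R sgn x)"
      using False by (simp add: sgn_div_norm)
    also have "\<dots> = (norm x)\<^sup>2 * (sgn x \<bullet> M (sgn x))"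
      by (simp only: linear_scale[OF \<open>linear M\<close>] inner_scaleR_left inner_scaleR_right
          mult.assoc power2_eq_square)
    finally have "x \<bullet> M x = (norm x)\<^sup>2 * (sgn x \<bullet> M (sgn x))" .
    moreover have "w \<bullet> M w \<le> sgn x \<bullet> M (sgn x)"
      using w(2) sgn_in[OF that False] by blast
    ultimately show ?thesis
      by (simp add: dot_square_norm mult.commute mult_right_mono)
  qed simp
  with w(1) show ?thesis
    by (intro that) auto
qed

section \<open>The dichotomy\<close>

theorem lemma2p1:
  fixes M :: "'a :: {real_inner, complete_space} \<Rightarrow> 'a"
    and Q :: "'a set"
  assumes finite_dim: "\<exists>B :: 'a set. finite B \<and> span B = UNIV"
    and lin: "linear M"
    and selfadjoint: "\<forall>x y. M x \<bullet> y = x \<bullet> M y"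
    and "closed Q" and "convex Q" and "cone Q"
    and "interior Q \<noteq> {}"
    and bdry_pos: "\<forall>u \<in> frontier Q - {0}. u \<bullet> M u > 0"
  defines "P1 \<equiv> \<forall>u \<in> interior Q. u \<bullet> M u > 0"
    and "P2 \<equiv> \<exists>v \<in> uminus ` interior Q. \<exists>l::real. l \<ge> 0 \<and> M v = - l *\<^sub>R v \<and> - l *\<^sub>R v \<in> Q"
  shows "(P1 \<and> \<not> P2) \<or> (\<not> P1 \<and> P2)"
proof -
  have "\<not> P1" if "P2"
  proof -
    obtain w l where w: "w \<in> interior Q" "l \<ge> 0" "M (- w) = - l *\<^sub>R (- w)"
      using \<open>P2\<close> unfolding P2_def by blast
    then have "- M w = - (- l *\<^sub>R w)"
      by (simp add: linear_neg[OF lin])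
    then have "M w = - l *\<^sub>R w"
      by (simp only: neg_equal_iff_equal)
    then have "w \<bullet> M w \<le> 0"
      using w(2) by simp
    then show ?thesis
      using w(1) unfolding P1_def by (meson not_le)
  qed
  moreover have "P2" if "\<not> P1"
  proof (cases "0 \<in> interior Q")
    case True
    then have "0 \<in> uminus ` interior Q" "0 \<in> Q"
      using interior_subset by (force, blast)
    then show ?thesis
      unfolding P2_def using linear_0[OF lin]
      by (intro bexI[of _ 0] exI[of _ 0]) auto
  next
    case False
    obtain u where u: "u \<in> interior Q" "u \<bullet> M u \<le> 0"
      using \<open>\<not> P1\<close> unfolding P1_def by (meson not_le)
    then have uQ: "u \<in> Q" "u \<noteq> 0"
      using False interior_subset by auto
    obtain w where w: "w \<in> Q" "norm w = 1"
        "\<And>x. x \<in> Q \<Longrightarrow> (w \<bullet> M w) * (x \<bullet> x) \<le> x \<bullet> M x"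
      using finite_dim cone_rayleigh_minimiser[OF _ _ lin \<open>closed Q\<close> \<open>cone Q\<close> uQ] by metis
    define \<mu> where "\<mu> = w \<bullet> M w"
    have "\<mu> * (u \<bullet> u) \<le> 0"
      using w(3)[OF uQ(1)] u(2) unfolding \<mu>_def by linarith
    moreover have "0 < u \<bullet> u"
      using uQ(2) by (simp only: inner_gt_zero_iff not_False_eq_True)
    ultimately have "\<mu> \<le> 0"
      by (auto simp only: mult_le_0_iff)
    have "w \<notin> frontier Q"
      using bdry_pos w(2) \<open>\<mu> \<le> 0\<close> unfolding \<mu>_def by force
    then have w_int: "w \<in> interior Q"
      using w(1) closure_subset unfolding frontier_def by blast
    \<comment> \<open>By homogeneity the minimality of \<open>w\<close> says that \<open>M - \<mu>\<close> has a nonnegative form on \<open>Q\<close>.\<close>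
    define A where "A = (\<lambda>x. M x - \<mu> *\<^sub>R x)"
    have "A w = 0"
    proof (rule selfadjoint_kernel_of_interior_zero[of A Q w])
      show "linear A"
        unfolding A_def by (intro linear_compose_sub lin linear_scaleR)
      show "A x \<bullet> y = x \<bullet> A y" for x y
        using selfadjoint by (simp add: A_def inner_diff)
      show "0 \<le> x \<bullet> A x" if "x \<in> Q" for x
        using w(3)[OF that] by (simp add: A_def \<mu>_def inner_diff)
      show "w \<bullet> A w = 0"
        using w(2) by (simp add: A_def \<mu>_def inner_diff dot_square_norm)
    qed (rule w_int)
    then have "M (- w) = - (- \<mu>) *\<^sub>R (- w)"
      by (simp add: A_def linear_neg[OF lin])
    moreover have "- (- \<mu>) *\<^sub>R (- w) \<in> Q"
      using mem_cone[OF \<open>cone Q\<close> w(1), of "- \<mu>"] \<open>\<mu> \<le> 0\<close> by simp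
    ultimately show ?thesis
      unfolding P2_def using w_int \<open>\<mu> \<le> 0\<close>
      by (intro bexI[of _ "- w"] exI[of _ "- \<mu>"]) auto
  qed
  ultimately show ?thesis
    by blast
qed

end
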